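(* For $1\le i,j\le n$, $$G_{ij}=\frac{h^2}{S(1,n+1)}\begin{cases}S(1,i)\,S(j+1,n+1), & i\le j,\\ S(1,j)\,S(i+1,n+1), & i>j.\end{cases}$$ In particular, $G_{ij}>0$ and $G_{ij}=G_{ji}$. Moreover, with $\Delta_iG^{(j)}:=G_{i+1,j}-G_{ij}$ (for $1\le i\le n-1$, $1\le j\le n$), $$\beta_{i+\frac12}\Delta_iG^{(j)}=\frac{h^2}{S(1,n+1)}\begin{cases}S(j+1,n+1), & i<j,\\ -S(1,j), & i\ge j.\end{cases}$$ Consequently, for $1<i<n$ and $1\le j\le n$, $$\beta_{i-\frac12}\Delta_{i-1}G^{(j)}-\beta_{i+\frac12}\Delta_iG^{(j)}=h^2\delta_{ij}.$$ Thus, for every fixed $j$, the weighted increments $\beta_{i+\frac12}\Delta_iG^{(j)}$ take one constant value for all $i<j$ and another constant value for all $i\ge j$.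
   Context: Let $a<b$, let $n\ge 1$ be an integer, $h=(b-a)/(n+1)$, and let $\beta_{i+\frac12}>0$, $i=0,\ldots,n$, be given positive real numbers (face coefficients). $A_h$ is the $n\times n$ tridiagonal matrix acting on $U=(U_1,\ldots,U_n)^T$, with the convention $U_0=U_{n+1}=0$, by $$(A_hU)_i=-\beta_{i-\frac12}U_{i-1}+\left(\beta_{i-\frac12}+\beta_{i+\frac12}\right)U_i-\beta_{i+\frac12}U_{i+1},\qquad 1\le i\le n.$$ Set $L_h:=h^{-2}A_h$ and define the discrete Green's kernel $G_{ij}:=(L_h^{-1})_{ij}$, $1\le i,j\le n$. Set $s_k:=1/\beta_{k-\frac12}$ for $k=1,\ldots,n+1$, and $S(c,d):=\sum_{k=c}^{d}s_k$ if $c\le d$, $S(c,d):=0$ if $c>d$. $\delta_{ij}$ is the Kronecker delta. *)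

theory Defs
  imports Complex_Main "Jordan_Normal_Form.Gauss_Jordan_Elimination"
begin

(* Face coefficients live at half-integers; they are stored with the index rounded down:
   \<beta> i stands for \<beta>_{i+1/2}, so \<beta>_{i-1/2} is \<beta> (i - 1) for i \<ge> 1.
   Nodes are numbered 1..n as usual, whereas matrices and vectors are indexed from 0,
   so node i is row/column i - 1. *)

definition A_entry :: "(nat \<Rightarrow> real) \<Rightarrow> nat \<Rightarrow> nat \<Rightarrow> real" where
  "A_entry \<beta> i j =
     (if j + 1 = i then - \<beta> (i - 1)
      else if j = i then \<beta> (i - 1) + \<beta> i
      else if j = i + 1 then - \<beta> i
      else 0)"

definition A_mat :: "nat \<Rightarrow> (nat \<Rightarrow> real) \<Rightarrow> real mat" where
  "A_mat n \<beta> = mat n n (\<lambda>(r, c). A_entry \<beta> (r + 1) (c + 1))"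

(* Node values of a grid vector, with the convention U_0 = U_{n+1} = 0. *)
definition node :: "nat \<Rightarrow> real vec \<Rightarrow> nat \<Rightarrow> real" where
  "node n U i = (if 1 \<le> i \<and> i \<le> n then U $ (i - 1) else 0)"

(* The matrix above is the one acting by the three-point scheme. *)
lemma A_mat_action:
  assumes U: "U \<in> carrier_vec n" and i: "1 \<le> i" "i \<le> n"
  shows "node n (A_mat n \<beta> *\<^sub>v U) i =
           - \<beta> (i - 1) * node n U (i - 1) + (\<beta> (i - 1) + \<beta> i) * node n U i
             - \<beta> i * node n U (i + 1)"
proof -
  have "node n (A_mat n \<beta> *\<^sub>v U) i = (\<Sum>c<n. A_entry \<beta> i (c + 1) * U $ c)"
    using U i by (simp add: node_def A_mat_def scalar_prod_def atLeast0LessThan)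
  also have "\<dots> = (\<Sum>c<n. (if c + 2 = i then - \<beta> (i - 1) * U $ c else 0)
      + (if c = i - 1 then (\<beta> (i - 1) + \<beta> i) * U $ c else 0)
      + (if c = i then - \<beta> i * U $ c else 0))"
    using i by (intro sum.cong) (auto simp: A_entry_def)
  also have "\<dots> = (\<Sum>c<n. if c + 2 = i then - \<beta> (i - 1) * U $ c else 0)
      + (\<Sum>c<n. if c = i - 1 then (\<beta> (i - 1) + \<beta> i) * U $ c else 0)
      + (\<Sum>c<n. if c = i then - \<beta> i * U $ c else 0)"
    by (simp add: sum.distrib)
  also have "(\<Sum>c<n. if c + 2 = i then - \<beta> (i - 1) * U $ c else 0)
      = - \<beta> (i - 1) * node n U (i - 1)"
  proof (cases "i = 1")
    case False
    then have "(\<Sum>c<n. if c + 2 = i then - \<beta> (i - 1) * U $ c else 0)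
        = (\<Sum>c<n. if c = i - 2 then - \<beta> (i - 1) * U $ c else 0)"
      using i by (intro sum.cong) auto
    also have "\<dots> = - \<beta> (i - 1) * U $ (i - 2)"
      using i False by (subst sum.delta) auto
    also have "U $ (i - 2) = node n U (i - 1)"
    proof -
      have "1 \<le> i - 1 \<and> i - 1 \<le> n" "i - 1 - 1 = i - 2" using i False by auto
      then show ?thesis unfolding node_def by metis
    qed
    finally show ?thesis .
  qed (simp add: node_def)
  also have "(\<Sum>c<n. if c = i - 1 then (\<beta> (i - 1) + \<beta> i) * U $ c else 0)
      = (\<beta> (i - 1) + \<beta> i) * node n U i"
    using i by (subst sum.delta) (auto simp: node_def)
  also have "(\<Sum>c<n. if c = i then - \<beta> i * U $ c else 0) = - \<beta> i * node n U (i + 1)"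
    by (subst sum.delta) (auto simp: node_def)
  finally show ?thesis by simp
qed

definition L_mat :: "nat \<Rightarrow> real \<Rightarrow> (nat \<Rightarrow> real) \<Rightarrow> real mat" where
  "L_mat n h \<beta> = (1 / h\<^sup>2) \<cdot>\<^sub>m A_mat n \<beta>"

(* Meaningful only when L_mat n h \<beta> is invertible. *)
definition green :: "nat \<Rightarrow> real \<Rightarrow> (nat \<Rightarrow> real) \<Rightarrow> nat \<Rightarrow> nat \<Rightarrow> real" where
  "green n h \<beta> i j = the (mat_inverse (L_mat n h \<beta>)) $$ (i - 1, j - 1)"

definition s_coeff :: "(nat \<Rightarrow> real) \<Rightarrow> nat \<Rightarrow> real" where
  "s_coeff \<beta> k = 1 / \<beta> (k - 1)"

definition S :: "(nat \<Rightarrow> real) \<Rightarrow> nat \<Rightarrow> nat \<Rightarrow> real" where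
  "S \<beta> c d = (if c \<le> d then (\<Sum>k = c..d. s_coeff \<beta> k) else 0)"

definition green_incr :: "nat \<Rightarrow> real \<Rightarrow> (nat \<Rightarrow> real) \<Rightarrow> nat \<Rightarrow> nat \<Rightarrow> real" where
  "green_incr n h \<beta> i j = green n h \<beta> (i + 1) j - green n h \<beta> i j"

end

theory Submission
  imports Defs "Jordan_Normal_Form.Determinant"
begin

text \<open>
  Away from the source node \<open>j\<close> the flux \<open>\<beta>\<^sub>i\<^sub>+\<^sub>1\<^sub>/\<^sub>2 (u\<^sub>i\<^sub>+\<^sub>1 - u\<^sub>i)\<close> of a discrete harmonic function is constant,
  so the function is affine in the resistance coordinate \<open>i \<mapsto> S 1 i\<close>. Column \<open>j\<close> of the
  Green's kernel is therefore a hat in this coordinate: it rises from \<open>0\<close> at node \<open>0\<close> up to node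
  \<open>j\<close>, descends to \<open>0\<close> at node \<open>n + 1\<close>, and its height is fixed by the jump of the
  flux at \<open>j\<close>.

  The proof verifies that this \<open>hat\<close> inverts the operator. Up to a common factor its flux is the
  resistance to the right of the source on the rising branch and minus the resistance to the left
  of the source on the descending branch (\<open>flux_hat\<close>). These two resistances add up to the total
  \<open>S 1 (n + 1)\<close>, so the flux drops by exactly \<open>h\<^sup>2\<close> at \<open>j\<close> and nowhere else
  (\<open>flux_drop_hat\<close>). The three-point scheme computes precisely this drop, with the boundary
  convention matched by the zeros of the hat at both ends; hence the matrix of the hats is a right
  inverse of \<open>L_mat\<close>, and by finite dimension it is the inverse. All remaining claims are read
  off from the hat and its fluxes.
\<close>

lemma S_Suc_right: "S \<beta> 1 (Suc i) = S \<beta> 1 i + 1 / \<beta> i"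
  by (cases i) (simp_all add: S_def s_coeff_def)

lemma S_head: "i \<le> m \<Longrightarrow> S \<beta> (i + 1) (m + 1) = 1 / \<beta> i + S \<beta> (i + 2) (m + 1)"
  by (cases "i = m") (auto simp: S_def s_coeff_def sum.atLeast_Suc_atMost)

lemma S_split: "j \<le> m \<Longrightarrow> S \<beta> 1 j + S \<beta> (j + 1) m = S \<beta> 1 m"
proof (induction j)
  case (Suc j)
  then show ?case
    using S_head[of j "m - 1" \<beta>] S_Suc_right[of \<beta> j] by simp
qed (simp add: S_def)

lemma S_pos:
  assumes "\<forall>i\<in>{0..n}. \<beta> i > 0" "1 \<le> c" "c \<le> d" "d \<le> n + 1"
  shows "S \<beta> c d > 0"
  using assms by (auto simp: S_def s_coeff_def intro!: sum_pos)

text \<open>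
  The formula is used for \<open>i = 0, \<dots>, n + 1\<close> and \<open>j = 1, \<dots>, n\<close>: it also gives the boundary
  values \<open>0\<close>, so the first and the last face need no separate flux computation.
\<close>
definition hat :: "nat \<Rightarrow> real \<Rightarrow> (nat \<Rightarrow> real) \<Rightarrow> nat \<Rightarrow> nat \<Rightarrow> real" where
  "hat n h \<beta> i j = h\<^sup>2 / S \<beta> 1 (n + 1) *
     (if i \<le> j then S \<beta> 1 i * S \<beta> (j + 1) (n + 1)
      else S \<beta> 1 j * S \<beta> (i + 1) (n + 1))"

lemma hat_boundary:
  shows "hat n h \<beta> 0 j = 0" and "j \<le> n \<Longrightarrow> hat n h \<beta> (n + 1) j = 0"
  by (simp_all add: hat_def S_def)

lemma hat_sym: "hat n h \<beta> i j = hat n h \<beta> j i"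
  by (auto simp: hat_def)

lemma hat_pos:
  assumes "\<forall>i\<in>{0..n}. \<beta> i > 0" "h \<noteq> 0" "i \<in> {1..n}" "j \<in> {1..n}"
  shows "hat n h \<beta> i j > 0"
  using assms by (auto simp: hat_def intro!: mult_pos_pos divide_pos_pos S_pos[of n])

text \<open>
  One step of the grid changes the resistance coordinate by \<open>1 / \<beta> i\<close>, which the factor \<open>\<beta> i\<close>
  cancels, so only the slope of the current branch of the hat remains.
\<close>
lemma flux_hat:
  assumes "\<beta> i \<noteq> 0" "i \<le> n"
  shows "\<beta> i * (hat n h \<beta> (i + 1) j - hat n h \<beta> i j)
    = h\<^sup>2 / S \<beta> 1 (n + 1) * (if i < j then S \<beta> (j + 1) (n + 1) else - S \<beta> 1 j)"
proof -
  define q where "q = h\<^sup>2 / S \<beta> 1 (n + 1)"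
  consider "i < j" | "i = j" | "i > j" by linarith
  then have "\<beta> i * (hat n h \<beta> (i + 1) j - hat n h \<beta> i j)
    = q * (if i < j then S \<beta> (j + 1) (n + 1) else - S \<beta> 1 j)"
    unfolding hat_def q_def[symmetric]
    using assms
    by cases (simp_all add: S_Suc_right[of _ i, unfolded One_nat_def]
        S_head[of i n, simplified] S_head[of j n, simplified] field_simps)
  then show ?thesis by (simp add: q_def)
qed

text \<open>
  Both neighbouring fluxes lie on the same branch unless \<open>i = j\<close>; at the source the resistances to
  its left and right sum to \<open>S 1 (n + 1)\<close>, which is what the normalisation of the hat divides by.
\<close>
lemma flux_drop_hat:
  assumes \<beta>: "\<forall>i\<in>{0..n}. \<beta> i > 0" and i: "i \<in> {1..n}" and j: "j \<in> {1..n}"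
  shows "\<beta> (i - 1) * (hat n h \<beta> i j - hat n h \<beta> (i - 1) j)
      - \<beta> i * (hat n h \<beta> (i + 1) j - hat n h \<beta> i j)
    = h\<^sup>2 * (if i = j then 1 else 0)"
proof -
  have nz: "\<beta> (i - 1) \<noteq> 0" "\<beta> i \<noteq> 0"
    using \<beta> i by (auto simp: less_imp_neq[symmetric])
  define q where "q = h\<^sup>2 / S \<beta> 1 (n + 1)"
  have left: "\<beta> (i - 1) * (hat n h \<beta> i j - hat n h \<beta> (i - 1) j)
      = q * (if i \<le> j then S \<beta> (j + 1) (n + 1) else - S \<beta> 1 j)"
  proof -
    obtain k where "i = k + 1" "k \<le> n" using i by (cases i) auto
    then show ?thesis
      using flux_hat[of \<beta> k n h j] nz(1) by (simp add: q_def Suc_le_eq)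
  qed
  have right: "\<beta> i * (hat n h \<beta> (i + 1) j - hat n h \<beta> i j)
      = q * (if i < j then S \<beta> (j + 1) (n + 1) else - S \<beta> 1 j)"
    using flux_hat[of \<beta> i n h j] nz(2) i by (simp add: q_def)
  have "q * (S \<beta> 1 j + S \<beta> (j + 1) (n + 1)) = h\<^sup>2"
    using S_split[of j "n + 1" \<beta>] S_pos[OF \<beta>, of 1 "n + 1"] j by (simp add: q_def)
  then show ?thesis
    unfolding left right by (auto simp: distrib_left)
qed

text \<open>
  Each column of the product is the three-point scheme applied to one hat, that is, a flux drop.
\<close>
lemma L_mat_mult_hat:
  assumes \<beta>: "\<forall>i\<in>{0..n}. \<beta> i > 0" and h: "h \<noteq> 0"
  shows "L_mat n h \<beta> * mat n n (\<lambda>(r, c). hat n h \<beta> (r + 1) (c + 1)) = 1\<^sub>m n"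
    (is "_ * ?K = _")
proof (rule eq_matI)
  fix r c assume "r < dim_row (1\<^sub>m n)" "c < dim_col (1\<^sub>m n)"
  then have r: "r < n" and c: "c < n" by auto
  have A: "A_mat n \<beta> \<in> carrier_mat n n" by (simp add: A_mat_def)
  have node_col: "node n (col ?K c) i = hat n h \<beta> i (c + 1)" if "i \<le> n + 1" for i
  proof (cases "i \<in> {1..n}")
    case False
    with that have "i = 0 \<or> i = n + 1" by auto
    then show ?thesis
      using c hat_boundary(1)[of n h \<beta> "c + 1"] hat_boundary(2)[of "c + 1" n h \<beta>] by (auto simp: node_def)
  qed (use c in \<open>auto simp: node_def\<close>)
  have "(A_mat n \<beta> * ?K) $$ (r, c) = node n (A_mat n \<beta> *\<^sub>v col ?K c) (r + 1)"
    using A r c by (simp add: node_def)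
  also have "\<dots> = - \<beta> r * hat n h \<beta> r (c + 1)
      + (\<beta> r + \<beta> (r + 1)) * hat n h \<beta> (r + 1) (c + 1)
      - \<beta> (r + 1) * hat n h \<beta> (r + 2) (c + 1)"
    using r A_mat_action[of "col ?K c" n "r + 1" \<beta>, OF carrier_vecI]
      node_col[of r] node_col[of "r + 1"] node_col[of "r + 2"] by simp
  also have "\<dots> = h\<^sup>2 * (if r = c then 1 else 0)"
    using flux_drop_hat[OF \<beta>, of "r + 1" "c + 1" h] r c by (simp add: algebra_simps)
  finally show "(L_mat n h \<beta> * ?K) $$ (r, c) = 1\<^sub>m n $$ (r, c)"
    using A r c h by (simp add: L_mat_def)
qed (auto simp: L_mat_def A_mat_def)

text \<open>
  Over a field a one-sided inverse of a square matrix is two-sided, so \<open>A\<close> is a unit; this rules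
  out the result \<open>None\<close>, and inverses are unique.
\<close>
lemma mat_inverse_eqI:
  fixes A B :: "'a :: field mat"
  assumes A: "A \<in> carrier_mat n n" and B: "B \<in> carrier_mat n n" and AB: "A * B = 1\<^sub>m n"
  shows "mat_inverse A = Some B"
proof -
  have BA: "B * A = 1\<^sub>m n" by (rule mat_mult_left_right_inverse[OF A B AB])
  show ?thesis
  proof (cases "mat_inverse A")
    case None
    moreover have "A \<in> Units (ring_mat TYPE('a) n ())"
      using A B AB BA by (auto simp: Units_def ring_mat_simps)
    ultimately show ?thesis using mat_inverse(1)[OF A, where b = "()"] by blast
  next
    case (Some C)
    then have C: "A * C = 1\<^sub>m n" "C \<in> carrier_mat n n"
      using mat_inverse(2)[OF A] by auto
    have "C = B * A * C" using BA C by simp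
    also have "\<dots> = B * (A * C)" by (rule assoc_mult_mat[OF B A C(2)])
    also have "\<dots> = B" using B C by simp
    finally show ?thesis using Some by simp
  qed
qed

lemma L_mat_carrier: "L_mat n h \<beta> \<in> carrier_mat n n"
  by (simp add: L_mat_def A_mat_def)

lemma invertible_L_mat:
  assumes "\<forall>i\<in>{0..n}. \<beta> i > 0" "h \<noteq> 0"
  shows "invertible_mat (L_mat n h \<beta>)"
proof -
  define K where "K = mat n n (\<lambda>(r, c). hat n h \<beta> (r + 1) (c + 1))"
  have K: "K \<in> carrier_mat n n" and LK: "L_mat n h \<beta> * K = 1\<^sub>m n"
    using L_mat_mult_hat[OF assms] by (simp_all add: K_def)
  have "K * L_mat n h \<beta> = 1\<^sub>m n"
    by (rule mat_mult_left_right_inverse[OF L_mat_carrier K LK])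
  then show ?thesis
    using L_mat_carrier[of n h \<beta>] K LK
    unfolding invertible_mat_def inverts_mat_def square_mat.simps by auto
qed

lemma green_eq_hat:
  assumes "\<forall>i\<in>{0..n}. \<beta> i > 0" "h \<noteq> 0" "i \<in> {1..n}" "j \<in> {1..n}"
  shows "green n h \<beta> i j = hat n h \<beta> i j"
  using mat_inverse_eqI[OF L_mat_carrier _ L_mat_mult_hat[OF assms(1,2)]] assms(3,4)
  by (auto simp: green_def)

theorem proposition2p2:
  fixes a b h :: real and n :: nat and \<beta> :: "nat \<Rightarrow> real"
  assumes "a < b" and "n \<ge> 1"
    and "h = (b - a) / (real n + 1)"
    and "\<forall>i\<in>{0..n}. \<beta> i > 0"
  shows "invertible_mat (L_mat n h \<beta>)
    \<and> (\<forall>i\<in>{1..n}. \<forall>j\<in>{1..n}.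
         green n h \<beta> i j = h\<^sup>2 / S \<beta> 1 (n + 1) *
           (if i \<le> j then S \<beta> 1 i * S \<beta> (j + 1) (n + 1)
            else S \<beta> 1 j * S \<beta> (i + 1) (n + 1)))
    \<and> (\<forall>i\<in>{1..n}. \<forall>j\<in>{1..n}.
         green n h \<beta> i j > 0 \<and> green n h \<beta> i j = green n h \<beta> j i)
    \<and> (\<forall>i\<in>{1..n - 1}. \<forall>j\<in>{1..n}.
         \<beta> i * green_incr n h \<beta> i j = h\<^sup>2 / S \<beta> 1 (n + 1) *
           (if i < j then S \<beta> (j + 1) (n + 1) else - S \<beta> 1 j))
    \<and> (\<forall>i\<in>{1<..<n}. \<forall>j\<in>{1..n}.
         \<beta> (i - 1) * green_incr n h \<beta> (i - 1) j - \<beta> i * green_incr n h \<beta> i j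
           = h\<^sup>2 * (if i = j then 1 else 0))
    \<and> (\<forall>j\<in>{1..n}. \<exists>c d. c \<noteq> d \<and>
         (\<forall>i\<in>{1..n - 1}. \<beta> i * green_incr n h \<beta> i j = (if i < j then c else d)))"
proof (intro conjI ballI)
  have h: "h \<noteq> 0" using assms(1,3) by (auto simp: add_nonneg_eq_0_iff)
  note \<beta> = assms(4)
  note G = green_eq_hat[OF \<beta> h]
  have incr: "green_incr n h \<beta> i j = hat n h \<beta> (i + 1) j - hat n h \<beta> i j"
    if "i \<in> {1..n - 1}" "j \<in> {1..n}" for i j
    using that G[of i j] G[of "i + 1" j] by (auto simp: green_incr_def)
  have flux: "\<beta> i * green_incr n h \<beta> i j = h\<^sup>2 / S \<beta> 1 (n + 1) *
      (if i < j then S \<beta> (j + 1) (n + 1) else - S \<beta> 1 j)"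
    if "i \<in> {1..n - 1}" "j \<in> {1..n}" for i j
  proof -
    have "i \<le> n" "\<beta> i \<noteq> 0" using that \<beta> by (auto simp: less_imp_neq[symmetric])
    then show ?thesis using flux_hat[of \<beta> i n h j] incr[OF that] by simp
  qed
  show "invertible_mat (L_mat n h \<beta>)" by (rule invertible_L_mat[OF \<beta> h])
  fix j assume j: "j \<in> {1..n}"
  {
    fix i assume i: "i \<in> {1..n}"
    show "green n h \<beta> i j = h\<^sup>2 / S \<beta> 1 (n + 1) *
           (if i \<le> j then S \<beta> 1 i * S \<beta> (j + 1) (n + 1)
            else S \<beta> 1 j * S \<beta> (i + 1) (n + 1))"
      using G[OF i j] by (simp add: hat_def)
    show "green n h \<beta> i j > 0"
      using G[OF i j] hat_pos[OF \<beta> h i j] by simp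
    show "green n h \<beta> i j = green n h \<beta> j i"
      using G[OF i j] G[OF j i] hat_sym by simp
  }
  {
    fix i assume "i \<in> {1..n - 1}"
    then show "\<beta> i * green_incr n h \<beta> i j = h\<^sup>2 / S \<beta> 1 (n + 1) *
           (if i < j then S \<beta> (j + 1) (n + 1) else - S \<beta> 1 j)"
      using flux j by blast
  }
  {
    fix i assume i: "i \<in> {1<..<n}"
    then have "i \<in> {1..n}" "i - 1 \<in> {1..n - 1}" "i \<in> {1..n - 1}" "i - 1 + 1 = i" by auto
    then show "\<beta> (i - 1) * green_incr n h \<beta> (i - 1) j - \<beta> i * green_incr n h \<beta> i j
           = h\<^sup>2 * (if i = j then 1 else 0)"
      using incr j flux_drop_hat[OF \<beta>, of i j h] by metis
  }
  let ?c = "h\<^sup>2 / S \<beta> 1 (n + 1) * S \<beta> (j + 1) (n + 1)"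
  let ?d = "h\<^sup>2 / S \<beta> 1 (n + 1) * - S \<beta> 1 j"
  have "S \<beta> 1 (n + 1) > 0" "S \<beta> (j + 1) (n + 1) > 0" "S \<beta> 1 j > 0"
    using j by (auto intro!: S_pos[OF \<beta>])
  then have "?c > 0" "?d < 0"
    using h by (auto simp: zero_less_mult_iff mult_less_0_iff)
  then have "?c \<noteq> ?d" by linarith
  moreover have "\<forall>i\<in>{1..n - 1}. \<beta> i * green_incr n h \<beta> i j = (if i < j then ?c else ?d)"
    using flux j by simp
  ultimately show "\<exists>c d. c \<noteq> d \<and>
         (\<forall>i\<in>{1..n - 1}. \<beta> i * green_incr n h \<beta> i j = (if i < j then c else d))"
    by blast
qed

end
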